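(* If $G$ is a doubly regular tournament of order $n$, then $$(1+o(1))\log_2 n\le\zeta(G)\le\beta(G)\le 2\log_2 n,$$ where the asymptotics are as $n\to\infty$.
   Context: A tournament is a finite digraph with no loops in which each pair of distinct vertices is joined by exactly one arc. A tournament of order $n$ is doubly regular if it is regular (every vertex has in-degree and out-degree $(n-1)/2$) and for every pair of distinct vertices $x,y$ the number of common out-neighbors of $x$ and $y$, and likewise the number of common in-neighbors of $x$ and $y$, equals $(n-3)/4$. $d(u,v)$ is the length of a shortest directed path from $u$ to $v$, and $d(u,v)=\infty$ if there is no such path. The metric dimension $\beta(G)$ is the minimum number $k$ of vertices $u_1,\dots,u_k$ of $G$ such that the vectors $(d(u_1,x),\ldots,d(u_k,x))$, $x\in V(G)$, are pairwise distinct; equivalently, it is the minimum number of cops needed to win the Localization game on $G$ in one round. The Localization game with $k$ cops on a digraph $G$: an invisible robber first chooses a vertex; in each round the cops choose vertices $u_1,\dots,u_k$ (any vertices, chosen afresh each round) and learn the distance vector $(d(u_1,x),\ldots,d(u_k,x))$, where $x$ is the robber's current vertex; then the robber stays at $x$ or moves along an arc $(x,y)$ to an out-neighbor $y$. The cops win if they have a strategy which, whatever the robber does, after finitely many rounds determines a unique possible vertex for the robber right after a probe (using all information received so far); otherwise the robber wins. The localization number $\zeta(G)$ is the least positive integer $k$ for which $k$ cops have a winning strategy. *)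

theory Defs
  imports "Graph_Theory.Graph_Theory" "HOL-Library.Landau_Symbols"
begin

locale tournament = digraph +
  assumes unique_arc:
    "\<lbrakk>u \<in> verts G; v \<in> verts G; u \<noteq> v\<rbrakk> \<Longrightarrow> \<exists>!e. arc e (u, v) \<or> arc e (v, u)"

text \<open>The degree conditions are equations between reals, so that nothing is truncated.\<close>

locale doubly_regular_tournament = tournament +
  assumes out_regular:
    "v \<in> verts G \<Longrightarrow> real (out_degree G v) = (real (card (verts G)) - 1) / 2"
  and in_regular:
    "v \<in> verts G \<Longrightarrow> real (in_degree G v) = (real (card (verts G)) - 1) / 2"
  and common_out_neighbours:
    "\<lbrakk>x \<in> verts G; y \<in> verts G; x \<noteq> y\<rbrakk> \<Longrightarrow>
      real (card {z \<in> verts G. x \<rightarrow> z \<and> y \<rightarrow> z}) = (real (card (verts G)) - 3) / 4"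
  and common_in_neighbours:
    "\<lbrakk>x \<in> verts G; y \<in> verts G; x \<noteq> y\<rbrakk> \<Longrightarrow>
      real (card {z \<in> verts G. z \<rightarrow> x \<and> z \<rightarrow> y}) = (real (card (verts G)) - 3) / 4"

context wf_digraph
begin

text \<open>
  With unit weights, the infimum of the costs of all walks is the length of a shortest
  directed path, and it is \<open>\<infinity>\<close> if there is none.
\<close>

definition ddist :: "'a \<Rightarrow> 'a \<Rightarrow> ereal" where
  "ddist u v = \<mu> (\<lambda>_. 1) u v"

definition distance_vector :: "'a list \<Rightarrow> 'a \<Rightarrow> ereal list" where
  "distance_vector us x = map (\<lambda>u. ddist u x) us"

definition metric_dimension :: nat where
  "metric_dimension =
    (LEAST k. \<exists>us. length us = k \<and> set us \<subseteq> verts G \<and> inj_on (distance_vector us) (verts G))"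

text \<open>
  A strategy for \<open>k\<close> cops maps the list of distance vectors received in the previous rounds
  to the next probe; the previous probes are themselves determined by these vectors.
  Cops may share a vertex, so a probe is a list of length \<open>k\<close>, possibly with repetitions.
\<close>

definition cop_strategy :: "nat \<Rightarrow> (ereal list list \<Rightarrow> 'a list) \<Rightarrow> bool" where
  "cop_strategy k \<sigma> \<longleftrightarrow> (\<forall>h. length (\<sigma> h) = k \<and> set (\<sigma> h) \<subseteq> verts G)"

text \<open>\<open>r t\<close> is the position of the robber when the probe of round \<open>t\<close> is made,
  rounds being counted from \<open>0\<close>.\<close>

definition robber_play :: "(nat \<Rightarrow> 'a) \<Rightarrow> bool" where
  "robber_play r \<longleftrightarrow> r 0 \<in> verts G \<and> (\<forall>t. r (Suc t) = r t \<or> r t \<rightarrow> r (Suc t))"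

primrec answers :: "(ereal list list \<Rightarrow> 'a list) \<Rightarrow> (nat \<Rightarrow> 'a) \<Rightarrow> nat \<Rightarrow> ereal list list" where
  "answers \<sigma> r 0 = []"
| "answers \<sigma> r (Suc t) = answers \<sigma> r t @ [distance_vector (\<sigma> (answers \<sigma> r t)) (r t)]"

text \<open>
  The vertices on which the robber can be right after the probe of round \<open>t\<close>, given the
  answers to the probes of rounds \<open>0, \<dots>, t\<close>.
\<close>

definition possible_positions :: "(ereal list list \<Rightarrow> 'a list) \<Rightarrow> (nat \<Rightarrow> 'a) \<Rightarrow> nat \<Rightarrow> 'a set" where
  "possible_positions \<sigma> r t =
    {r' t | r'. robber_play r' \<and> answers \<sigma> r' (Suc t) = answers \<sigma> r (Suc t)}"

definition cops_win :: "nat \<Rightarrow> bool" where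
  "cops_win k \<longleftrightarrow>
    (\<exists>\<sigma>. cop_strategy k \<sigma> \<and>
      (\<forall>r. robber_play r \<longrightarrow> (\<exists>t v. possible_positions \<sigma> r t = {v})))"

definition localization_number :: nat where
  "localization_number = (LEAST k. 0 < k \<and> cops_win k)"

end

end

theory Submission
  imports Defs "HOL-Real_Asymp.Real_Asymp"
begin

text \<open>
  Between distinct vertices \<open>u\<close>, \<open>x\<close> of a doubly regular tournament the distance is \<open>1\<close> if
  \<open>u \<rightarrow> x\<close> and \<open>2\<close> otherwise, because the out-neighbours of \<open>u\<close> are too many to be
  out-neighbours of \<open>x\<close> as well. So the answer to a probe says little more than which of the
  probed vertices dominate the robber, and both bounds are counting arguments.

  Upper bound. Regularity says that fewer than half of the vertices fail to separate a given pair,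
  namely the common in-neighbours and the common out-neighbours. Hence the fraction of
  lists of \<open>k\<close> vertices that fail on the pair is at most \<open>1 / 2 ^ k\<close>, and a union bound over the
  \<open>n choose 2\<close> pairs leaves a good list as soon as \<open>2 ^ k\<close> exceeds \<open>n choose 2\<close>
  (lemmas \<open>ex_list_hitting\<close> and \<open>metric_dimension_le\<close>). A list that separates all pairs
  locates the robber in one round, which gives the middle inequality.

  Lower bound. A robber at \<open>x\<close> has \<open>(n + 1) / 2\<close> vertices available for the next round, while
  a probe with \<open>k\<close> cops has at most \<open>2 ^ k\<close> answers on the vertices that carry no cop.
  If \<open>n > 2 ^ (k + 2)\<close>, then two of the available vertices give the same answer, and the robber
  moves to one of them; repeating this he is never located
  (lemmas \<open>robber_evades\<close> and \<open>cops_win_imp_card_le\<close>). So \<open>\<zeta> \<ge> log 2 n - 2\<close>, and the error term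
  is \<open>\<epsilon> n = - 2 / log 2 n\<close>.
\<close>

section \<open>A union bound for lists\<close>

text \<open>
  If every \<open>p\<close> is hit by at least half of the elements of \<open>V\<close>, then a random list of length \<open>k\<close>
  misses a fixed \<open>p\<close> with probability at most \<open>1 / 2 ^ k\<close>.
\<close>

lemma ex_list_hitting:
  fixes D :: "'a \<Rightarrow> 'p \<Rightarrow> bool"
  assumes "finite V" "V \<noteq> {}" "finite P" "card P < 2 ^ k"
    and half: "\<And>p. p \<in> P \<Longrightarrow> 2 * card {u \<in> V. \<not> D u p} \<le> card V"
  shows "\<exists>us. length us = k \<and> set us \<subseteq> V \<and> (\<forall>p\<in>P. \<exists>u\<in>set us. D u p)"
proof (rule ccontr)
  assume none: "\<not> ?thesis"
  define lists_over where "lists_over A = {us. set us \<subseteq> A \<and> length us = k}" for A :: "'a set"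
  define bad where "bad p = lists_over {u \<in> V. \<not> D u p}" for p
  have bad_bound: "2 ^ k * card (bad p) \<le> card V ^ k" if "p \<in> P" for p
  proof -
    have "card (bad p) = card {u \<in> V. \<not> D u p} ^ k"
      unfolding bad_def lists_over_def using \<open>finite V\<close> by (intro card_lists_length_eq) auto
    then have "2 ^ k * card (bad p) = (2 * card {u \<in> V. \<not> D u p}) ^ k"
      by (simp add: power_mult_distrib)
    also have "\<dots> \<le> card V ^ k"
      using half[OF that] by (rule power_mono) simp
    finally show ?thesis .
  qed
  have fin: "finite (bad p)" for p
    unfolding bad_def lists_over_def using \<open>finite V\<close> by (intro finite_lists_length_eq) auto
  have "lists_over V \<subseteq> (\<Union>p\<in>P. bad p)"
  proof
    fix us
    assume "us \<in> lists_over V"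
    then have us: "length us = k" "set us \<subseteq> V"
      by (auto simp: lists_over_def)
    then obtain p where "p \<in> P" "\<forall>u\<in>set us. \<not> D u p"
      using none by blast
    with us have "us \<in> bad p"
      by (auto simp: bad_def lists_over_def)
    with \<open>p \<in> P\<close> show "us \<in> (\<Union>p\<in>P. bad p)"
      by blast
  qed
  then have "card (lists_over V) \<le> card (\<Union>p\<in>P. bad p)"
    using fin \<open>finite P\<close> by (intro card_mono) auto
  also have "\<dots> \<le> (\<Sum>p\<in>P. card (bad p))"
    using \<open>finite P\<close> by (rule card_UN_le)
  finally have "2 ^ k * card (lists_over V) \<le> (\<Sum>p\<in>P. 2 ^ k * card (bad p))"
    by (simp flip: sum_distrib_left)
  also have "\<dots> \<le> (\<Sum>p\<in>P. card V ^ k)"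
    using bad_bound by (rule sum_mono)
  also have "\<dots> = card P * card V ^ k"
    by simp
  also have "\<dots> < 2 ^ k * card V ^ k"
    using assms by (simp add: card_gt_0_iff)
  finally show False
    unfolding lists_over_def using \<open>finite V\<close> by (simp add: card_lists_length_eq)
qed

section \<open>Distances\<close>

context wf_digraph
begin

lemma ddist_eq_lengthI:
  assumes "awalk u p v" and shortest: "\<And>q. awalk u q v \<Longrightarrow> length p \<le> length q"
  shows "ddist u v = ereal (real (length p))"
proof -
  have cost: "awalk_cost (\<lambda>_. 1) q = real (length q)" for q :: "'b list"
    by (induction q) auto
  show ?thesis
    unfolding ddist_def
  proof (rule antisym)
    show "\<mu> (\<lambda>_. 1) u v \<le> ereal (real (length p))"
      using min_cost_le_walk_cost[OF assms(1), of "\<lambda>_. 1"] by (simp add: cost)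
    show "ereal (real (length p)) \<le> \<mu> (\<lambda>_. 1) u v"
      unfolding \<mu>_def using shortest by (intro INF_greatest) (simp add: cost)
  qed
qed

lemma ddist_self: "v \<in> verts G \<Longrightarrow> ddist v v = 0"
  using ddist_eq_lengthI[of v "[]" v] by (simp add: awalk_Nil_iff)

lemma ddist_dominates:
  assumes "u \<rightarrow> v" "u \<noteq> v"
  shows "ddist u v = 1"
proof -
  obtain e where e: "e \<in> arcs G" "tail G e = u" "head G e = v"
    using assms(1) by blast
  have "1 \<le> length q" if "awalk u q v" for q
    using that assms(2) by (cases q) (auto simp: awalk_Nil_iff)
  then show ?thesis
    using ddist_eq_lengthI[of u "[e]" v] arc_implies_awalk[OF e(1)] e by simp
qed

lemma ddist_two_step:
  assumes "u \<rightarrow> w" "w \<rightarrow> v" "u \<noteq> v" "\<not> u \<rightarrow> v"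
  shows "ddist u v = 2"
proof -
  obtain e where e: "e \<in> arcs G" "tail G e = u" "head G e = w"
    using assms(1) by blast
  obtain f where f: "f \<in> arcs G" "tail G f = w" "head G f = v"
    using assms(2) by blast
  have walk: "awalk u [e, f] v"
    using e f by (auto simp: awalk_simps)
  have shortest: "length [e, f] \<le> length q" if q: "awalk u q v" for q
  proof -
    have "q \<noteq> []"
      using q assms(3) by (auto simp: awalk_Nil_iff)
    moreover have "q \<noteq> [a]" for a
      using q assms(4) dominatesI[of a u v] by (auto simp: awalk_simps arc_to_ends_def)
    ultimately show ?thesis
      by (cases q; cases "tl q") auto
  qed
  show ?thesis
    using ddist_eq_lengthI[OF walk shortest] by simp
qed

section \<open>The Localization game\<close>

text \<open>Probing the vertices of a resolving list wins in the first round.\<close>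

lemma cops_win_if_resolving:
  assumes "set us \<subseteq> verts G" "inj_on (distance_vector us) (verts G)"
  shows "cops_win (length us)"
proof -
  define \<sigma> where "\<sigma> = (\<lambda>_ :: ereal list list. us)"
  have "possible_positions \<sigma> r 0 = {r 0}" if "robber_play r" for r
  proof -
    have "r' 0 = r 0" if "robber_play r'" "answers \<sigma> r' (Suc 0) = answers \<sigma> r (Suc 0)" for r'
      using that \<open>robber_play r\<close> assms(2) by (auto simp: robber_play_def \<sigma>_def dest: inj_onD)
    then show ?thesis
      using \<open>robber_play r\<close> unfolding possible_positions_def by blast
  qed
  moreover have "cop_strategy (length us) \<sigma>"
    using assms(1) by (simp add: cop_strategy_def \<sigma>_def)
  ultimately show ?thesis
    unfolding cops_win_def by blast
qed

lemma answers_cong: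
  "(\<And>i. i < t \<Longrightarrow> r i = r' i) \<Longrightarrow> answers \<sigma> r t = answers \<sigma> r' t"
  by (induction t) auto

text \<open>
  A robber who knows the next probe moves to one of two vertices that it does not tell apart;
  the other one, reached by the same moves up to the last, is then also a possible position.
  As the cops' strategy is deterministic, he does know the next probe.
\<close>

lemma robber_evades:
  assumes "verts G \<noteq> {}"
    and confused: "\<And>us x. \<lbrakk>length us = k; set us \<subseteq> verts G; x \<in> verts G\<rbrakk> \<Longrightarrow>
      \<not> inj_on (distance_vector us) (insert x {y. x \<rightarrow> y})"
  shows "\<not> cops_win k"
proof
  assume "cops_win k"
  then obtain \<sigma> where \<sigma>: "cop_strategy k \<sigma>"
    and win: "\<And>r. robber_play r \<Longrightarrow> \<exists>t v. possible_positions \<sigma> r t = {v}"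
    unfolding cops_win_def by blast
  obtain x\<^sub>0 where x\<^sub>0: "x\<^sub>0 \<in> verts G"
    using assms(1) by blast
  let ?N = "\<lambda>x. insert x {y. x \<rightarrow> y}"
  have "\<forall>h x. x \<in> verts G \<longrightarrow> (\<exists>y. y \<in> ?N x \<and>
    (\<exists>y'. y' \<in> ?N x \<and> y' \<noteq> y \<and> distance_vector (\<sigma> h) y' = distance_vector (\<sigma> h) y))"
    using confused \<sigma> unfolding cop_strategy_def inj_on_def by metis
  then obtain f where f: "\<And>h x. x \<in> verts G \<Longrightarrow> f h x \<in> ?N x \<and>
    (\<exists>y'. y' \<in> ?N x \<and> y' \<noteq> f h x \<and> distance_vector (\<sigma> h) y' = distance_vector (\<sigma> h) (f h x))"
    by metis
  \<comment> \<open>The state of the game is the list of past answers with the robber's current position.\<close>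
  define s where "s = rec_nat ([], f [] x\<^sub>0)
    (\<lambda>_ (h, x). let h' = h @ [distance_vector (\<sigma> h) x] in (h', f h' x))"
  define r where "r t = snd (s t)" for t
  have hist: "fst (s t) = answers \<sigma> r t" for t
    by (induction t) (auto simp: s_def r_def Let_def split: prod.splits)
  define prev where "prev t = (case t of 0 \<Rightarrow> x\<^sub>0 | Suc i \<Rightarrow> r i)" for t
  have r: "r t = f (answers \<sigma> r t) (prev t)" for t
  proof (cases t)
    case 0
    then show ?thesis
      by (simp add: r_def s_def prev_def)
  next
    case (Suc i)
    have "r (Suc i) = f (fst (s (Suc i))) (r i)"
      by (simp add: r_def s_def Let_def split: prod.splits)
    then show ?thesis
      unfolding hist Suc prev_def by simp
  qed
  have N_verts: "?N x \<subseteq> verts G" if "x \<in> verts G" for x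
    using that by (auto dest: adj_in_verts)
  have prev_verts: "prev t \<in> verts G" for t
  proof (induction t)
    case 0
    then show ?case
      using x\<^sub>0 by (simp add: prev_def)
  next
    case (Suc t)
    have "r t \<in> ?N (prev t)"
      using f[OF Suc] by (subst r) blast
    then show ?case
      using N_verts[OF Suc] by (auto simp: prev_def)
  qed
  have r_N: "r t \<in> ?N (prev t)" for t
    using f[OF prev_verts] by (subst r) blast
  have play: "robber_play r"
    unfolding robber_play_def
  proof (intro conjI allI)
    show "r 0 \<in> verts G"
      using r_N[of 0] N_verts[OF prev_verts] by blast
    show "r (Suc t) = r t \<or> r t \<rightarrow> r (Suc t)" for t
      using r_N[of "Suc t"] by (simp add: prev_def)
  qed
  obtain t v where tv: "possible_positions \<sigma> r t = {v}"
    using win[OF play] by blast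
  obtain y where y: "y \<in> ?N (prev t)" "y \<noteq> r t"
    "distance_vector (\<sigma> (answers \<sigma> r t)) y = distance_vector (\<sigma> (answers \<sigma> r t)) (r t)"
    using f[OF prev_verts, of "answers \<sigma> r t" t] by (auto simp flip: r)
  define r' where "r' i = (if i < t then r i else y)" for i
  have "robber_play r'"
    unfolding robber_play_def
  proof (intro conjI allI)
    have "y \<in> verts G"
      using y(1) N_verts[OF prev_verts] by blast
    then show "r' 0 \<in> verts G"
      using play by (simp add: r'_def robber_play_def)
    show "r' (Suc i) = r' i \<or> r' i \<rightarrow> r' (Suc i)" for i
    proof (cases "t = Suc i")
      case True
      then show ?thesis
        using y(1) by (auto simp: r'_def prev_def)
    next
      case False
      then show ?thesis
        using play by (auto simp: r'_def robber_play_def)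
    qed
  qed
  moreover have "answers \<sigma> r' t = answers \<sigma> r t"
    by (rule answers_cong) (simp add: r'_def)
  then have "answers \<sigma> r' (Suc t) = answers \<sigma> r (Suc t)"
    using y(3) by (simp add: r'_def)
  moreover have "r' t = y"
    by (simp add: r'_def)
  ultimately have "y \<in> possible_positions \<sigma> r t"
    unfolding possible_positions_def by blast
  moreover have "r t \<in> possible_positions \<sigma> r t"
    using play unfolding possible_positions_def by blast
  ultimately show False
    using tv y(2) by simp
qed

end

section \<open>Doubly regular tournaments\<close>

context tournament
begin

lemma dominates_total:
  assumes "u \<in> verts G" "v \<in> verts G" "u \<noteq> v"
  shows "u \<rightarrow> v \<or> v \<rightarrow> u"
proof -
  obtain e where "arc e (u, v) \<or> arc e (v, u)"
    using unique_arc[OF assms] by blast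
  then show ?thesis
    by (auto simp: arc_def arc_to_ends_def intro: dominatesI)
qed

end

lemma (in digraph) card_out_neighbours: "card {v. u \<rightarrow> v} = out_degree G u"
proof -
  have "{v. u \<rightarrow> v} = head G ` out_arcs G u"
    by (auto simp: arcs_ends_conv)
  moreover have "inj_on (head G) (out_arcs G u)"
    by (auto intro!: inj_onI no_multi_arcs simp: arc_to_ends_def)
  ultimately show ?thesis
    by (simp add: out_degree_def card_image)
qed

context doubly_regular_tournament
begin

lemma finite_out_neighbours: "finite {v. u \<rightarrow> v}"
  by (rule finite_subset[OF _ finite_verts]) (auto dest: adj_in_verts)

lemma ddist_eq:
  assumes "u \<in> verts G" "v \<in> verts G"
  shows "ddist u v = (if u = v then 0 else if u \<rightarrow> v then 1 else 2)"
proof -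
  have "ddist u v = 2" if "u \<noteq> v" "\<not> u \<rightarrow> v"
  proof -
    have "\<exists>w. u \<rightarrow> w \<and> \<not> v \<rightarrow> w"
    proof (rule ccontr)
      assume "\<not> ?thesis"
      then have "{w \<in> verts G. u \<rightarrow> w \<and> v \<rightarrow> w} = {w. u \<rightarrow> w}"
        by (auto dest: adj_in_verts)
      \<comment> \<open>The degree of \<open>u\<close> would agree with the number of common out-neighbours.\<close>
      then have "(real (card (verts G)) - 3) / 4 = (real (card (verts G)) - 1) / 2"
        using common_out_neighbours[OF assms that(1)] out_regular[OF assms(1)]
        by (simp add: card_out_neighbours)
      then show False
        by (simp add: field_simps)
    qed
    then obtain w where w: "u \<rightarrow> w" "\<not> v \<rightarrow> w"
      by blast
    moreover from w that have "w \<rightarrow> v"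
      using dominates_total[OF _ assms(2)] adj_in_verts(2)[OF w(1)] by blast
    ultimately show ?thesis
      using that ddist_two_step by blast
  qed
  then show ?thesis
    using assms by (auto simp: ddist_self ddist_dominates)
qed

text \<open>
  By \<open>ddist_eq\<close>, a vertex fails to separate \<open>x\<close> and \<open>y\<close> only if it is a common in-neighbour or a
  common out-neighbour, and there are \<open>(n - 3) / 4\<close> vertices of either kind.
\<close>

lemma card_not_separating:
  assumes "x \<in> verts G" "y \<in> verts G" "x \<noteq> y"
  shows "2 * card {u \<in> verts G. ddist u x = ddist u y} \<le> card (verts G)"
proof -
  let ?O = "{u \<in> verts G. x \<rightarrow> u \<and> y \<rightarrow> u}" and ?I = "{u \<in> verts G. u \<rightarrow> x \<and> u \<rightarrow> y}"
  have "{u \<in> verts G. ddist u x = ddist u y} \<subseteq> ?O \<union> ?I"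
  proof
    fix u
    assume "u \<in> {u \<in> verts G. ddist u x = ddist u y}"
    then have "u \<in> verts G" "u \<noteq> x" "u \<noteq> y" "u \<rightarrow> x \<longleftrightarrow> u \<rightarrow> y"
      using assms by (auto simp: ddist_eq split: if_splits)
    then show "u \<in> ?O \<union> ?I"
      using dominates_total[OF \<open>u \<in> verts G\<close>] assms by blast
  qed
  then have "card {u \<in> verts G. ddist u x = ddist u y} \<le> card (?O \<union> ?I)"
    by (intro card_mono) auto
  also have "\<dots> \<le> card ?O + card ?I"
    by (rule card_Un_le)
  finally have "real (card {u \<in> verts G. ddist u x = ddist u y}) \<le> real (card ?O) + real (card ?I)"
    by linarith
  then show ?thesis
    using common_out_neighbours[OF assms] common_in_neighbours[OF assms] by simp
qed

lemma ex_resolving_list: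
  assumes "verts G \<noteq> {}" "card (verts G) choose 2 < 2 ^ k"
  shows "\<exists>us. length us = k \<and> set us \<subseteq> verts G \<and> inj_on (distance_vector us) (verts G)"
proof -
  let ?P = "{A. A \<subseteq> verts G \<and> card A = 2}"
  have "2 * card {u \<in> verts G. \<not> inj_on (ddist u) A} \<le> card (verts G)" if "A \<in> ?P" for A
  proof -
    obtain x y where A: "A = {x, y}" "x \<noteq> y"
      using \<open>A \<in> ?P\<close> by (auto simp: card_2_iff)
    then have "{u \<in> verts G. \<not> inj_on (ddist u) A} = {u \<in> verts G. ddist u x = ddist u y}"
      by auto
    then show ?thesis
      using card_not_separating[of x y] A \<open>A \<in> ?P\<close> by simp
  qed
  then obtain us where us: "length us = k" "set us \<subseteq> verts G"
    and sep: "\<And>A. A \<in> ?P \<Longrightarrow> \<exists>u\<in>set us. inj_on (ddist u) A"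
    using ex_list_hitting[of "verts G" ?P k "\<lambda>u A. inj_on (ddist u) A"] assms
    by (auto simp: n_subsets)
  have "inj_on (distance_vector us) (verts G)"
  proof (rule inj_onI, rule ccontr)
    fix x y
    assume xy: "x \<in> verts G" "y \<in> verts G" "distance_vector us x = distance_vector us y" "x \<noteq> y"
    then show False
      using sep[of "{x, y}"] by (auto simp: distance_vector_def)
  qed
  with us show ?thesis
    by blast
qed

text \<open>The integer \<open>k = \<lfloor>2 log 2 n\<rfloor>\<close> is large enough, as \<open>n choose 2 < n\<^sup>2 / 2 < 2 ^ k\<close>.\<close>

lemma metric_dimension_le:
  assumes "verts G \<noteq> {}"
  shows "real metric_dimension \<le> 2 * log 2 (real (card (verts G)))"
proof -
  define n where "n = card (verts G)"
  have "n > 0"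
    using assms by (simp add: n_def card_gt_0_iff)
  define k where "k = nat \<lfloor>2 * log 2 (real n)\<rfloor>"
  have log_nonneg: "0 \<le> log 2 (real n)"
    using \<open>n > 0\<close> by simp
  have k: "real k \<le> 2 * log 2 (real n)" "2 * log 2 (real n) < real k + 1"
    using log_nonneg by (simp_all add: k_def)
  have "real n ^ 2 = (2 powr log 2 (real n)) powr 2"
    using \<open>n > 0\<close> by simp
  also have "\<dots> = 2 powr (2 * log 2 (real n))"
    by (simp only: powr_powr mult.commute)
  also have "\<dots> < 2 powr (real (Suc k))"
    using k(2) by simp
  also have "\<dots> = real (2 ^ Suc k)"
    by (simp add: powr_realpow del: of_nat_Suc)
  finally have "n ^ 2 < 2 ^ Suc k"
    by (metis of_nat_less_iff of_nat_power)
  moreover have "2 * (n choose 2) \<le> n * (n - 1)"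
    by (simp add: choose_two)
  moreover have "n * (n - 1) \<le> n ^ 2"
    by (simp add: power2_eq_square)
  ultimately have "n choose 2 < 2 ^ k"
    unfolding power_Suc by linarith
  then have "metric_dimension \<le> k"
    unfolding metric_dimension_def n_def using ex_resolving_list[OF assms] by (intro Least_le)
  then show ?thesis
    using k(1) unfolding n_def by linarith
qed

lemma localization_number_cops_win:
  assumes "2 \<le> card (verts G)"
  shows "cops_win localization_number" "localization_number \<le> metric_dimension"
proof -
  have "verts G \<noteq> {}"
    using assms by auto
  have "card (verts G) choose 2 < 2 ^ (card (verts G) choose 2)"
    by (rule less_exp)
  then obtain us where us: "length us = metric_dimension" "set us \<subseteq> verts G"
      "inj_on (distance_vector us) (verts G)"
    using LeastI_ex[of "\<lambda>k. \<exists>us. length us = k \<and> set us \<subseteq> verts G \<and>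
      inj_on (distance_vector us) (verts G)"] ex_resolving_list[OF \<open>verts G \<noteq> {}\<close>]
    unfolding metric_dimension_def by blast
  have "us \<noteq> []"
  proof
    assume "us = []"
    then have "card (verts G) \<le> card {[] :: ereal list}"
      using us(3) by (intro card_inj_on_le) (auto simp: distance_vector_def)
    then show False
      using assms by simp
  qed
  then have win: "0 < metric_dimension \<and> cops_win metric_dimension"
    using cops_win_if_resolving[OF us(2,3)] by (simp flip: us(1))
  then show "localization_number \<le> metric_dimension"
    unfolding localization_number_def by (rule Least_le)
  show "cops_win localization_number"
    using LeastI[of "\<lambda>k. 0 < k \<and> cops_win k", OF win] unfolding localization_number_def by blast
qed

text \<open>
  Vertices that carry no cop are at distance \<open>1\<close> or \<open>2\<close> from every cop, so at most \<open>2 ^ k\<close> of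
  them can be told apart.
\<close>

lemma not_inj_on_distance_vector:
  assumes us: "length us = k" "set us \<subseteq> verts G" and "A \<subseteq> verts G" "2 ^ k + k < card A"
  shows "\<not> inj_on (distance_vector us) A"
proof
  assume inj: "inj_on (distance_vector us) A"
  let ?W = "{ds. set ds \<subseteq> {1, 2 :: ereal} \<and> length ds = k}"
  have "distance_vector us ` (A - set us) \<subseteq> ?W"
    using assms by (auto simp: distance_vector_def ddist_eq subset_iff)
  then have "card (A - set us) \<le> card ?W"
    using inj by (intro card_inj_on_le[of "distance_vector us"])
      (auto intro: inj_on_subset finite_lists_length_eq)
  also have "card ?W = 2 ^ k"
    by (simp add: card_lists_length_eq flip: numeral_2_eq_2)
  finally have "card (A - set us) \<le> 2 ^ k" .
  moreover have "card A - card (set us) \<le> card (A - set us)"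
    by (rule diff_card_le_card_Diff) simp
  moreover have "card (set us) \<le> k"
    using card_length[of us] us(1) by simp
  ultimately show False
    using assms(4) by linarith
qed

lemma cops_win_imp_card_le:
  assumes "cops_win k"
  shows "card (verts G) \<le> 2 ^ (k + 2)"
proof (rule ccontr)
  assume large: "\<not> ?thesis"
  have "\<not> inj_on (distance_vector us) (insert x {y. x \<rightarrow> y})"
    if "length us = k" "set us \<subseteq> verts G" "x \<in> verts G" for us x
  proof (rule not_inj_on_distance_vector)
    show "insert x {y. x \<rightarrow> y} \<subseteq> verts G"
      using that by (auto dest: adj_in_verts)
    have "card (insert x {y. x \<rightarrow> y}) = Suc (out_degree G x)"
      using adj_not_same finite_out_neighbours
      by (subst card_insert_disjoint) (auto simp: card_out_neighbours)
    then have "2 * real (card (insert x {y. x \<rightarrow> y})) = real (card (verts G)) + 1"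
      using out_regular[OF that(3)] by simp
    then have "2 * card (insert x {y. x \<rightarrow> y}) = card (verts G) + 1"
      by linarith
    moreover have "4 * 2 ^ k < card (verts G)"
      using large by simp
    moreover have "k < 2 ^ k"
      by (rule less_exp)
    ultimately show "2 ^ k + k < card (insert x {y. x \<rightarrow> y})"
      by linarith
  qed (use that in auto)
  moreover have "verts G \<noteq> {}"
    using large by auto
  ultimately show False
    using robber_evades assms by blast
qed

lemma localization_number_ge:
  assumes "2 \<le> card (verts G)"
  shows "log 2 (real (card (verts G))) - 2 \<le> real localization_number"
proof -
  have "card (verts G) \<le> 2 ^ (localization_number + 2)"
    using cops_win_imp_card_le localization_number_cops_win(1)[OF assms] .
  then have "real (card (verts G)) \<le> 2 ^ (localization_number + 2)"
    by (metis of_nat_le_iff of_nat_numeral of_nat_power)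
  then have "log 2 (real (card (verts G))) \<le> log 2 (2 ^ (localization_number + 2))"
    using assms by (intro log_mono) auto
  also have "\<dots> = real (localization_number + 2)"
    by (simp only: log_pow_cancel)
  finally have "log 2 (real (card (verts G))) \<le> real (localization_number + 2)" .
  then show ?thesis
    by simp
qed

end

theorem corollary18:
  shows "\<exists>\<epsilon> :: nat \<Rightarrow> real. \<epsilon> \<in> o(\<lambda>_. 1) \<and>
    (\<forall>(G :: ('a, 'b) pre_digraph) n.
      doubly_regular_tournament G \<and> card (verts G) = n \<and> 2 \<le> n \<longrightarrow>
        (1 + \<epsilon> n) * log 2 (real n) \<le> real (wf_digraph.localization_number G) \<and>
        wf_digraph.localization_number G \<le> wf_digraph.metric_dimension G \<and>
        real (wf_digraph.metric_dimension G) \<le> 2 * log 2 (real n))"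
proof (intro exI conjI allI impI; (elim conjE)?)
  show "(\<lambda>n. - 2 / log 2 (real n)) \<in> o(\<lambda>_. 1)"
    by real_asymp
next
  fix G :: "('a, 'b) pre_digraph" and n
  assume "doubly_regular_tournament G" and n: "card (verts G) = n" "2 \<le> n"
  then interpret doubly_regular_tournament G
    by simp
  have "log 2 (real n) > 0"
    using n(2) by simp
  then have "(1 + - 2 / log 2 (real n)) * log 2 (real n) = log 2 (real n) - 2"
    by (simp add: field_simps)
  also have "\<dots> \<le> real localization_number"
    using localization_number_ge n by simp
  finally show "(1 + - 2 / log 2 (real n)) * log 2 (real n) \<le> real localization_number" .
  show "localization_number \<le> metric_dimension"
    using localization_number_cops_win(2) n by simp
  have "verts G \<noteq> {}"
    using n by auto
  then show "real metric_dimension \<le> 2 * log 2 (real n)"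
    using metric_dimension_le n by simp
qed

end
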